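(* Let $A$ be a non-empty set of atoms. The five equational axioms of $\mathrm{EqMSCL}$, namely (Neg) $\mathsf F=\neg\mathsf T$, (Or) $x\lor_s y=\neg(\neg x\land_s\neg y)$, (Tand) $\mathsf T\land_s x=x$, (Abs) $x\land_s(x\lor_s y)=x$, (Mem) $(x\lor_s y)\land_s z=(\neg x\land_s(y\land_s z))\lor_s(x\land_s z)$, are independent: none of them is derivable in equational logic from the other four.
   Context: Terms are built over the signature $\Sigma_{SCL}(A)=\{\land_s,\lor_s,\neg,\mathsf T,\mathsf F\}\cup A$, where each atom $a\in A$ is a constant, $\mathsf T,\mathsf F$ are constants, $\neg$ is unary and $\land_s,\lor_s$ (sequential, i.e. short-circuit, conjunction and disjunction) are binary, together with variables $x,y,z,\dots$. Derivability is derivability in equational logic (substitution, reflexivity, symmetry, transitivity, congruence). *)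

theory Defs
  imports Main
begin

text \<open>The set $A$ of atoms is the type \<open>'a\<close>, so it is arbitrary, and non-empty because every HOL
  type is. The variables $x, y, z, \dots$ are indexed by the natural numbers.\<close>

datatype 'a scl_term =
    Var nat
  | Atom 'a
  | TT ("\<T>")
  | FF ("\<F>")
  | Neg "'a scl_term" ("\<not>\<^sub>s _" [75] 75)
  | Conj "'a scl_term" "'a scl_term" (infix "\<and>\<^sub>s" 70)
  | Disj "'a scl_term" "'a scl_term" (infix "\<or>\<^sub>s" 70)

primrec subst :: "(nat \<Rightarrow> 'a scl_term) \<Rightarrow> 'a scl_term \<Rightarrow> 'a scl_term" where
  "subst \<sigma> (Var n) = \<sigma> n"
| "subst \<sigma> (Atom a) = Atom a"
| "subst \<sigma> \<T> = \<T>"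
| "subst \<sigma> \<F> = \<F>"
| "subst \<sigma> (\<not>\<^sub>s s) = \<not>\<^sub>s (subst \<sigma> s)"
| "subst \<sigma> (s \<and>\<^sub>s t) = subst \<sigma> s \<and>\<^sub>s subst \<sigma> t"
| "subst \<sigma> (s \<or>\<^sub>s t) = subst \<sigma> s \<or>\<^sub>s subst \<sigma> t"

type_synonym 'a equation = "'a scl_term \<times> 'a scl_term"

inductive derivable :: "'a equation set \<Rightarrow> 'a scl_term \<Rightarrow> 'a scl_term \<Rightarrow> bool"
    ("_ \<turnstile> _ \<approx> _" [51, 51, 51] 50)
  for E :: "'a equation set" where
  Axm: "(s, t) \<in> E \<Longrightarrow> E \<turnstile> s \<approx> t"
| Subst: "E \<turnstile> s \<approx> t \<Longrightarrow> E \<turnstile> subst \<sigma> s \<approx> subst \<sigma> t"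
| Refl: "E \<turnstile> s \<approx> s"
| Sym: "E \<turnstile> s \<approx> t \<Longrightarrow> E \<turnstile> t \<approx> s"
| Trans: "E \<turnstile> s \<approx> t \<Longrightarrow> E \<turnstile> t \<approx> u \<Longrightarrow> E \<turnstile> s \<approx> u"
| Cong_Neg: "E \<turnstile> s \<approx> t \<Longrightarrow> E \<turnstile> \<not>\<^sub>s s \<approx> \<not>\<^sub>s t"
| Cong_Conj: "E \<turnstile> s \<approx> t \<Longrightarrow> E \<turnstile> u \<approx> v \<Longrightarrow> E \<turnstile> s \<and>\<^sub>s u \<approx> t \<and>\<^sub>s v"
| Cong_Disj: "E \<turnstile> s \<approx> t \<Longrightarrow> E \<turnstile> u \<approx> v \<Longrightarrow> E \<turnstile> s \<or>\<^sub>s u \<approx> t \<or>\<^sub>s v"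

abbreviation "vx \<equiv> Var 0"
abbreviation "vy \<equiv> Var 1"
abbreviation "vz \<equiv> Var 2"

definition ax_Neg :: "'a equation" where
  "ax_Neg = (\<F>, \<not>\<^sub>s \<T>)"

definition ax_Or :: "'a equation" where
  "ax_Or = (vx \<or>\<^sub>s vy, \<not>\<^sub>s (\<not>\<^sub>s vx \<and>\<^sub>s \<not>\<^sub>s vy))"

definition ax_Tand :: "'a equation" where
  "ax_Tand = (\<T> \<and>\<^sub>s vx, vx)"

definition ax_Abs :: "'a equation" where
  "ax_Abs = (vx \<and>\<^sub>s (vx \<or>\<^sub>s vy), vx)"

definition ax_Mem :: "'a equation" where
  "ax_Mem = ((vx \<or>\<^sub>s vy) \<and>\<^sub>s vz, (\<not>\<^sub>s vx \<and>\<^sub>s (vy \<and>\<^sub>s vz)) \<or>\<^sub>s (vx \<and>\<^sub>s vz))"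

definition EqMSCL :: "'a equation set" where
  "EqMSCL = {ax_Neg, ax_Or, ax_Tand, ax_Abs, ax_Mem}"

text \<open>The axioms are pairwise different, so removing one from the set leaves the other four.\<close>

lemma card_EqMSCL: "card (EqMSCL :: 'a equation set) = 5"
  by (simp add: EqMSCL_def ax_Neg_def ax_Or_def ax_Tand_def ax_Abs_def ax_Mem_def)

end

theory Submission
  imports Defs
begin

text \<open>By soundness, a derivable equation holds in every algebra satisfying the axioms, under
  every valuation (\<open>derivable_sound\<close>). So a model of four axioms with a valuation
  refuting the fifth shows underivability (\<open>not_derivableI\<close>). Each of the five models
  lives on \<open>bool\<close>, with operations chosen freely.\<close>

text \<open>Every axiom fails in some two-element algebra that satisfies the other four; such algebras
  can be found by exhaustive search. The value given to the atoms is irrelevant.\<close>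

primrec eval ::
  "('a \<Rightarrow> 'b) \<Rightarrow> 'b \<Rightarrow> 'b \<Rightarrow> ('b \<Rightarrow> 'b) \<Rightarrow> ('b \<Rightarrow> 'b \<Rightarrow> 'b) \<Rightarrow> ('b \<Rightarrow> 'b \<Rightarrow> 'b) \<Rightarrow>
    (nat \<Rightarrow> 'b) \<Rightarrow> 'a scl_term \<Rightarrow> 'b" where
  "eval \<alpha> t f n c d v (Var i) = v i"
| "eval \<alpha> t f n c d v (Atom a) = \<alpha> a"
| "eval \<alpha> t f n c d v \<T> = t"
| "eval \<alpha> t f n c d v \<F> = f"
| "eval \<alpha> t f n c d v (\<not>\<^sub>s p) = n (eval \<alpha> t f n c d v p)"
| "eval \<alpha> t f n c d v (p \<and>\<^sub>s q) = c (eval \<alpha> t f n c d v p) (eval \<alpha> t f n c d v q)"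
| "eval \<alpha> t f n c d v (p \<or>\<^sub>s q) = d (eval \<alpha> t f n c d v p) (eval \<alpha> t f n c d v q)"

lemma eval_subst:
  "eval \<alpha> t f n c d v (subst \<sigma> p) = eval \<alpha> t f n c d (\<lambda>i. eval \<alpha> t f n c d v (\<sigma> i)) p"
  by (induction p) simp_all

text \<open>The valuation must vary in the induction: by \<open>eval_subst\<close>, the
  \<open>Subst\<close> rule uses its premise at the valuation that evaluates \<sigma>.\<close>

lemma derivable_sound:
  assumes "E \<turnstile> p \<approx> q"
    and "\<And>p q v. (p, q) \<in> E \<Longrightarrow> eval \<alpha> t f n c d v p = eval \<alpha> t f n c d v q"
  shows "eval \<alpha> t f n c d v p = eval \<alpha> t f n c d v q"
  using assms(1) by (induction arbitrary: v) (simp_all add: assms(2) eval_subst)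

lemma not_derivableI:
  assumes "eval \<alpha> t f n c d v p \<noteq> eval \<alpha> t f n c d v q"
    and "\<And>p q v. (p, q) \<in> E \<Longrightarrow> eval \<alpha> t f n c d v p = eval \<alpha> t f n c d v q"
  shows "\<not> E \<turnstile> p \<approx> q"
  using assms derivable_sound by metis

lemmas axiom_defs = ax_Neg_def ax_Or_def ax_Tand_def ax_Abs_def ax_Mem_def

text \<open>Boolean logic with \<open>\<F>\<close> misread as true: no other axiom mentions
  \<open>\<F>\<close>.\<close>

lemma ax_Neg_independent: "\<not> EqMSCL - {(\<F>, \<not>\<^sub>s \<T>)} \<turnstile> \<F> \<approx> \<not>\<^sub>s \<T>"
  by (rule not_derivableI[where \<alpha> = "\<lambda>_. True" and t = True and f = True and n = Not
        and c = "(\<and>)" and d = "(\<or>)"])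
    (auto simp: EqMSCL_def axiom_defs)

text \<open>With conjunction the second and disjunction the first projection, both sides of Mem
  equal z, but those of Or are x and y.\<close>

lemma ax_Or_independent:
  "\<not> EqMSCL - {(vx \<or>\<^sub>s vy, \<not>\<^sub>s (\<not>\<^sub>s vx \<and>\<^sub>s \<not>\<^sub>s vy))} \<turnstile> vx \<or>\<^sub>s vy \<approx> \<not>\<^sub>s (\<not>\<^sub>s vx \<and>\<^sub>s \<not>\<^sub>s vy)"
  by (rule not_derivableI[where \<alpha> = "\<lambda>_. True" and t = True and f = True and n = "\<lambda>x. x"
        and c = "\<lambda>x y. y" and d = "\<lambda>x y. x" and v = "\<lambda>i. i = 0"])
    (auto simp: EqMSCL_def axiom_defs)

text \<open>False is a right unit of \<open>x \<and> \<not> y\<close>, which gives Abs, but is left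
  absorbing, which breaks Tand.\<close>

lemma ax_Tand_independent: "\<not> EqMSCL - {(\<T> \<and>\<^sub>s vx, vx)} \<turnstile> \<T> \<and>\<^sub>s vx \<approx> vx"
  by (rule not_derivableI[where \<alpha> = "\<lambda>_. True" and t = False and f = False and n = "\<lambda>_. False"
        and c = "\<lambda>x y. x \<and> \<not> y" and d = "\<lambda>_ _. False" and v = "\<lambda>_. True"])
    (auto simp: EqMSCL_def axiom_defs)

text \<open>Constantly false disjunction makes both sides of Mem false, and also the left side of
  Abs.\<close>

lemma ax_Abs_independent: "\<not> EqMSCL - {(vx \<and>\<^sub>s (vx \<or>\<^sub>s vy), vx)} \<turnstile> vx \<and>\<^sub>s (vx \<or>\<^sub>s vy) \<approx> vx"
  by (rule not_derivableI[where \<alpha> = "\<lambda>_. True" and t = True and f = False and n = "\<lambda>_. False"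
        and c = "(\<and>)" and d = "\<lambda>_ _. False" and v = "\<lambda>_. True"])
    (auto simp: EqMSCL_def axiom_defs)

text \<open>False is a two-sided unit of exclusive or, so Tand and Abs hold, while Mem reduces to z
  = False.\<close>

lemma ax_Mem_independent:
  "\<not> EqMSCL - {((vx \<or>\<^sub>s vy) \<and>\<^sub>s vz, (\<not>\<^sub>s vx \<and>\<^sub>s (vy \<and>\<^sub>s vz)) \<or>\<^sub>s (vx \<and>\<^sub>s vz))}
    \<turnstile> (vx \<or>\<^sub>s vy) \<and>\<^sub>s vz \<approx> (\<not>\<^sub>s vx \<and>\<^sub>s (vy \<and>\<^sub>s vz)) \<or>\<^sub>s (vx \<and>\<^sub>s vz)"
  by (rule not_derivableI[where \<alpha> = "\<lambda>_. True" and t = False and f = False and n = "\<lambda>_. False"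
        and c = "(\<noteq>)" and d = "\<lambda>_ _. False" and v = "\<lambda>_. True"])
    (auto simp: EqMSCL_def axiom_defs)

theorem theorem3p3:
  "\<forall>(s, t) \<in> (EqMSCL :: 'a equation set). \<not> (EqMSCL - {(s, t)} \<turnstile> s \<approx> t)"
proof -
  have "\<not> EqMSCL - {(s, t)} \<turnstile> s \<approx> t" if "(s, t) \<in> EqMSCL" for s t :: "'a scl_term"
    using that ax_Neg_independent ax_Or_independent ax_Tand_independent ax_Abs_independent
      ax_Mem_independent
    \<comment> \<open>Rewriting only membership in \<open>EqMSCL\<close> keeps
      \<open>EqMSCL - {(s, t)}\<close> folded, as in the five lemmas.\<close>
    unfolding EqMSCL_def[THEN eqset_imp_iff] axiom_defs insert_iff empty_iff prod.inject
    by metis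
  then show ?thesis by blast
qed

end
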